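(* Let $X$ and $Y$ be (integrable, real-valued) random variables with CDFs $F_X,F_Y$, let $\alpha\in(0,1)$ and $\epsilon\in[0,1]$. (1) Upper bound. Assume $P(X\le b_X)=1$ and $P(Y\le b_Y)=1$ for some real $b_X,b_Y$, and $F_Y(z)-F_X(z)\le\epsilon$ for all $z\in\mathbb{R}$. Then: (a) if $\alpha>\epsilon$, $$\mathrm{CVaR}_\alpha(X)\le \frac{\epsilon}{\alpha}\max(b_X,b_Y)+\Big(1-\frac{\epsilon}{\alpha}\Big)\mathrm{CVaR}_{\alpha-\epsilon}(Y);$$ (b) if $\alpha\le\epsilon$, then $\mathrm{CVaR}_\alpha(X)\le\max(b_X,b_Y)$. (2) Lower bound. Assume $P(X\ge a_X)=1$ and $P(Y\ge a_Y)=1$ for some real $a_X,a_Y$, and $F_X(z)-F_Y(z)\le\epsilon$ for all $z\in\mathbb{R}$. Then: (a) if $\alpha+\epsilon\le 1$, $$\mathrm{CVaR}_\alpha(X)\ge\Big(1+\frac{\epsilon}{\alpha}\Big)\mathrm{CVaR}_{\alpha+\epsilon}(Y)-\frac{\epsilon}{\alpha}\mathrm{CVaR}_\epsilon(Y);$$ (b) if $\alpha+\epsilon>1$ and $a_{\min}=\min(a_X,a_Y)$, $$\mathrm{CVaR}_\alpha(X)\ge\frac1\alpha\Big(\mathbb{E}[Y]-\epsilon\,\mathrm{CVaR}_\epsilon(Y)+(\alpha+\epsilon-1)a_{\min}\Big).$$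
   Context: All random variables are real-valued with finite first absolute moment. $F_X(x)=P(X\le x)$. For $\alpha\in(0,1]$, $\mathrm{CVaR}_\alpha(X)=\inf_{w\in\mathbb{R}}\{w+\frac1\alpha\mathbb{E}[(X-w)^+]\}$, with $(x)^+=\max(x,0)$. The product $\epsilon\,\mathrm{CVaR}_\epsilon(Y)$ is read as $0$ when $\epsilon=0$. *)

theory Defs
  imports "HOL-Probability.Probability"
begin

(* Intended for integrable X on a probability space M and level \<alpha> in (0,1]: then the objective is
   bounded below by the mean of X, so the real-valued infimum is the genuine one. At level 0 the
   value is meaningless (x / 0 = 0), but 0 * CVaR M 0 X = 0, as the product convention requires. *)
definition CVaR :: "'a measure \<Rightarrow> real \<Rightarrow> ('a \<Rightarrow> real) \<Rightarrow> real" where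
  "CVaR M \<alpha> X = (INF w::real. w + 1 / \<alpha> * (\<integral>\<omega>. max (X \<omega> - w) 0 \<partial>M))"

end

theory Submission
  imports Defs
begin

text \<open>Write \<open>h\<^sub>X(w) = E (X - w)\<^sup>+\<close>, so that \<open>\<alpha> CVaR\<^sub>\<alpha>(X)\<close> is the infimum of \<open>\<alpha> w + h\<^sub>X(w)\<close>.
  For \<open>w \<le> v\<close> the difference \<open>h\<^sub>X(w) - h\<^sub>X(v)\<close> is the integral of \<open>P(X > t)\<close> over \<open>[w, v)\<close>, hence
  a one-sided bound \<open>\<epsilon>\<close> between the distribution functions compares these differences for \<open>X\<close> and
  \<open>Y\<close> up to \<open>\<epsilon> (v - w)\<close>. For the upper bounds take \<open>v = max b\<^sub>X b\<^sub>Y\<close>, where \<open>h\<^sub>X\<close> and \<open>h\<^sub>Y\<close>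
  vanish. For the lower bounds, \<open>\<alpha> w + h\<^sub>X(w) + \<epsilon> v + h\<^sub>Y(v)\<close> is at least
  \<open>(\<alpha> + \<epsilon>) u + h\<^sub>Y(u)\<close> with \<open>u = min w v\<close>.\<close>

section \<open>Expected excess over a threshold\<close>

definition expected_excess :: "'a measure \<Rightarrow> ('a \<Rightarrow> real) \<Rightarrow> real \<Rightarrow> real" where
  "expected_excess M X w = (\<integral>\<omega>. max (X \<omega> - w) 0 \<partial>M)"

context prob_space
begin

lemma integrable_excess:
  "integrable M X \<Longrightarrow> integrable M (\<lambda>\<omega>. max (X \<omega> - w) 0)" for X :: "'a \<Rightarrow> real"
  by (intro integrable_max) auto

lemma expected_excess_nonneg: "0 \<le> expected_excess M X w"
  unfolding expected_excess_def by (rule integral_nonneg_AE) auto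

lemma expected_excess_ge_mean:
  assumes "integrable M X"
  shows "expectation X - w \<le> expected_excess M X w"
proof -
  have "(\<integral>\<omega>. X \<omega> - w \<partial>M) \<le> expected_excess M X w"
    unfolding expected_excess_def
    using assms by (intro integral_mono integrable_excess) auto
  then show ?thesis
    using assms by (simp add: prob_space)
qed

lemma expected_excess_antimono:
  assumes "integrable M X" "w \<le> v"
  shows "expected_excess M X v \<le> expected_excess M X w"
  unfolding expected_excess_def
  using assms by (intro integral_mono integrable_excess) auto

lemma expected_excess_eq_0:
  assumes "AE \<omega> in M. X \<omega> \<le> w"
  shows "expected_excess M X w = 0"
  unfolding expected_excess_def using assms by (intro integral_eq_zero_AE) auto

lemma expected_excess_eq_mean:
  assumes "integrable M X" "AE \<omega> in M. a \<le> X \<omega>" "w \<le> a"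
  shows "expected_excess M X w = expectation X - w"
proof -
  have "expected_excess M X w = (\<integral>\<omega>. X \<omega> - w \<partial>M)"
    unfolding expected_excess_def
    using assms by (intro integral_cong_AE) auto
  then show ?thesis
    using assms by (simp add: prob_space)
qed

text \<open>Dominated convergence: for thresholds w >= 0 the excess is at most |X|, and pointwise it
  is 0 once w exceeds the value of X. The limit settles level 0 in
  \<open>mult_CVaR_ge\<close>.\<close>

lemma expected_excess_tendsto_0:
  assumes "integrable M X"
  shows "(expected_excess M X \<longlongrightarrow> 0) at_top"
proof -
  have "((\<lambda>w. \<integral>\<omega>. max (X \<omega> - w) 0 \<partial>M) \<longlongrightarrow> (\<integral>\<omega>. 0 \<partial>M)) at_top"
  proof (rule integral_dominated_convergence_at_top[where w = "\<lambda>\<omega>. \<bar>X \<omega>\<bar>"])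
    show "AE \<omega> in M. ((\<lambda>w. max (X \<omega> - w) 0) \<longlongrightarrow> 0) at_top"
    proof (rule AE_I2, rule tendsto_eventually)
      show "\<forall>\<^sub>F w in at_top. max (X \<omega> - w) 0 = 0" for \<omega>
        using eventually_ge_at_top[of "X \<omega>"] by eventually_elim simp
    qed
    show "\<forall>\<^sub>F w in at_top. AE \<omega> in M. norm (max (X \<omega> - w) 0) \<le> \<bar>X \<omega>\<bar>"
      using eventually_ge_at_top[of 0] by eventually_elim auto
  qed (use assms in auto)
  then show ?thesis
    by (simp add: expected_excess_def[abs_def])
qed

text \<open>Layer-cake formula: for each outcome the difference of the two excesses is the length of
  [w, min v x) with x the value of X, and Tonelli exchanges this length integral with the
  expectation. In \<open>ennreal\<close> the exchange asks only for joint measurability.\<close>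

lemma expected_excess_diff:
  assumes X: "integrable M X" and "w \<le> v"
  shows "ennreal (expected_excess M X w - expected_excess M X v)
    = (\<integral>\<^sup>+t. ennreal (\<P>(\<omega> in M. t < X \<omega>)) * indicator {w..<v} t \<partial>lborel)"
proof -
  interpret P: pair_sigma_finite M lborel ..
  have [measurable]: "X \<in> borel_measurable M"
    using X by auto
  have "ennreal (expected_excess M X w - expected_excess M X v)
    = ennreal (\<integral>\<omega>. max (X \<omega> - w) 0 - max (X \<omega> - v) 0 \<partial>M)"
    unfolding expected_excess_def using X integrable_excess by simp
  also have "\<dots> = (\<integral>\<^sup>+\<omega>. ennreal (max (X \<omega> - w) 0 - max (X \<omega> - v) 0) \<partial>M)"
    using assms by (intro nn_integral_eq_integral[symmetric] Bochner_Integration.integrable_diff integrable_excess) auto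
  also have "\<dots> = (\<integral>\<^sup>+\<omega>. (\<integral>\<^sup>+t. indicator {w..<v} t * indicator {..<X \<omega>} t \<partial>lborel) \<partial>M)"
  proof (rule nn_integral_cong)
    fix \<omega>
    have "(\<integral>\<^sup>+t. indicator {w..<v} t * indicator {..<X \<omega>} t \<partial>lborel)
      = (\<integral>\<^sup>+t. indicator {w..<min v (X \<omega>)} t \<partial>lborel)"
      by (intro nn_integral_cong) (auto simp: indicator_def)
    also have "\<dots> = ennreal (max (X \<omega> - w) 0 - max (X \<omega> - v) 0)"
      using \<open>w \<le> v\<close> by (cases "w \<le> X \<omega>"; cases "v \<le> X \<omega>") (auto simp: max_def min_def)
    finally show "ennreal (max (X \<omega> - w) 0 - max (X \<omega> - v) 0)
      = (\<integral>\<^sup>+t. indicator {w..<v} t * indicator {..<X \<omega>} t \<partial>lborel)" ..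
  qed
  also have "\<dots> = (\<integral>\<^sup>+t. (\<integral>\<^sup>+\<omega>. indicator {w..<v} t * indicator {..<X \<omega>} t \<partial>M) \<partial>lborel)"
  proof (rule P.Fubini'[symmetric])
    show "(\<lambda>(\<omega>, t). indicator {w..<v} t * indicator {..<X \<omega>} t :: ennreal)
      \<in> borel_measurable (M \<Otimes>\<^sub>M lborel)"
      \<comment> \<open>The set \<open>{..<X \<omega>}\<close> varies with the outcome, so its
        indicator is first rewritten through the jointly measurable condition
        \<open>t < X \<omega>\<close>.\<close>
      unfolding indicator_def lessThan_iff by measurable
  qed
  also have "\<dots> = (\<integral>\<^sup>+t. ennreal (\<P>(\<omega> in M. t < X \<omega>)) * indicator {w..<v} t \<partial>lborel)"
  proof (rule nn_integral_cong)
    fix t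
    have "(\<integral>\<^sup>+\<omega>. indicator {..<X \<omega>} t \<partial>M) = (\<integral>\<^sup>+\<omega>. indicator {\<omega> \<in> space M. t < X \<omega>} \<omega> \<partial>M)"
      by (intro nn_integral_cong) (auto simp: indicator_def)
    also have "\<dots> = ennreal (\<P>(\<omega> in M. t < X \<omega>))"
      by (simp add: emeasure_eq_measure)
    finally show "(\<integral>\<^sup>+\<omega>. indicator {w..<v} t * indicator {..<X \<omega>} t \<partial>M)
      = ennreal (\<P>(\<omega> in M. t < X \<omega>)) * indicator {w..<v} t"
      by (cases "w \<le> t \<and> t < v") auto
  qed
  finally show ?thesis .
qed

section \<open>From distribution functions to tails, and CVaR as an infimum of expected
  excesses\<close>

lemma cdf_distr_eq_tail:
  assumes [measurable]: "X \<in> borel_measurable M"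
  shows "cdf (distr M borel X) z = 1 - \<P>(\<omega> in M. z < X \<omega>)"
proof -
  have "cdf (distr M borel X) z = \<P>(\<omega> in M. X \<omega> \<le> z)"
    by (auto simp: cdf_def measure_distr intro!: arg_cong[where f = prob])
  then show ?thesis
    using prob_neg[of "\<lambda>\<omega>. z < X \<omega>"] by (simp add: not_less)
qed

text \<open>An infimum of reals lies below its members only if they are bounded below. Here the mean
  of X is a lower bound, because the excess is nonnegative and 1 / \<alpha> >= 1.\<close>

lemma CVaR_le:
  assumes "integrable M X" "0 < \<alpha>" "\<alpha> \<le> 1"
  shows "CVaR M \<alpha> X \<le> w + 1 / \<alpha> * expected_excess M X w"
proof -
  have "expectation X \<le> u + 1 / \<alpha> * expected_excess M X u" for u
  proof -
    have "expected_excess M X u \<le> 1 / \<alpha> * expected_excess M X u"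
      using assms expected_excess_nonneg[of X u] mult_right_mono[of 1 "1 / \<alpha>"] by simp
    then show ?thesis
      using expected_excess_ge_mean[OF assms(1), of u] by simp
  qed
  then show ?thesis
    unfolding CVaR_def expected_excess_def[symmetric]
    by (intro cINF_lower bdd_belowI[of _ "expectation X"]) auto
qed

lemma mult_CVaR_le:
  assumes "integrable M X" "0 < \<alpha>" "\<alpha> \<le> 1"
  shows "\<alpha> * CVaR M \<alpha> X \<le> \<alpha> * w + expected_excess M X w"
proof -
  have "\<alpha> * CVaR M \<alpha> X \<le> \<alpha> * (w + 1 / \<alpha> * expected_excess M X w)"
    using CVaR_le[OF assms] assms(2) by simp
  also have "\<dots> = \<alpha> * w + expected_excess M X w"
    using assms(2) by (simp add: distrib_left)
  finally show ?thesis .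
qed

text \<open>The form multiplied by \<alpha> also covers level 0: there the product is 0, and letting
  w tend to infinity in the assumption gives c <= 0.\<close>

lemma mult_CVaR_ge:
  assumes "integrable M X" "0 \<le> \<alpha>" "\<And>w. c \<le> \<alpha> * w + expected_excess M X w"
  shows "c \<le> \<alpha> * CVaR M \<alpha> X"
proof (cases "\<alpha> = 0")
  case True
  then show ?thesis
    using assms(3) tendsto_lowerbound[OF expected_excess_tendsto_0[OF assms(1)], of c] by simp
next
  case False
  with assms(2) have "0 < \<alpha>" by simp
  have "c / \<alpha> \<le> CVaR M \<alpha> X"
    unfolding CVaR_def expected_excess_def[symmetric]
  proof (rule cINF_greatest)
    show "c / \<alpha> \<le> w + 1 / \<alpha> * expected_excess M X w" for w
      using assms(3)[of w] \<open>0 < \<alpha>\<close> by (simp add: field_simps)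
  qed simp
  then show ?thesis
    using \<open>0 < \<alpha>\<close> by (simp add: field_simps)
qed

end

section \<open>Comparison of two variables, and the upper bounds\<close>

lemma expected_excess_compare:
  assumes "prob_space M" "prob_space N" "integrable M X" "integrable N Y"
    and cdf: "\<And>z. cdf (distr N borel Y) z - cdf (distr M borel X) z \<le> \<epsilon>"
    and "0 \<le> \<epsilon>" "w \<le> v"
  shows "expected_excess M X w - expected_excess M X v
    \<le> expected_excess N Y w - expected_excess N Y v + \<epsilon> * (v - w)"
proof -
  interpret M: prob_space M by fact
  interpret N: prob_space N by fact
  have [measurable]: "X \<in> borel_measurable M" "Y \<in> borel_measurable N"
    using assms by auto
  \<comment> \<open>Passing to complements reverses the order: a bound on F_Y - F_X says that the
    tail of X exceeds that of Y by at most \<epsilon>.\<close>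
  have tail: "\<P>(\<omega> in M. t < X \<omega>) \<le> \<P>(\<omega> in N. t < Y \<omega>) + \<epsilon>" for t
    using cdf[of t] by (simp add: M.cdf_distr_eq_tail N.cdf_distr_eq_tail)
  \<comment> \<open>This sign allows sums to be formed under \<open>ennreal\<close> and the final
    inequality to be read back in the reals.\<close>
  have Y: "0 \<le> expected_excess N Y w - expected_excess N Y v"
    using N.expected_excess_antimono[OF assms(4,7)] by simp
  have "ennreal (expected_excess M X w - expected_excess M X v)
    = (\<integral>\<^sup>+t. ennreal (\<P>(\<omega> in M. t < X \<omega>)) * indicator {w..<v} t \<partial>lborel)"
    by (rule M.expected_excess_diff) fact+
  also have "\<dots> \<le> (\<integral>\<^sup>+t. ennreal (\<P>(\<omega> in N. t < Y \<omega>)) * indicator {w..<v} t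
      + ennreal \<epsilon> * indicator {w..<v} t \<partial>lborel)"
    using tail \<open>0 \<le> \<epsilon>\<close>
    by (intro nn_integral_mono) (auto simp: indicator_def ennreal_plus[symmetric] simp del: ennreal_plus)
  also have "\<dots> = (\<integral>\<^sup>+t. ennreal (\<P>(\<omega> in N. t < Y \<omega>)) * indicator {w..<v} t \<partial>lborel)
      + (\<integral>\<^sup>+t. ennreal \<epsilon> * indicator {w..<v} t \<partial>lborel)"
    by (rule nn_integral_add) measurable
  also have "\<dots> = ennreal (expected_excess N Y w - expected_excess N Y v) + ennreal \<epsilon> * ennreal (v - w)"
    using assms N.expected_excess_diff[OF assms(4,7)] by (simp add: nn_integral_cmult_indicator)
  also have "\<dots> = ennreal (expected_excess N Y w - expected_excess N Y v + \<epsilon> * (v - w))"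
    using Y assms by (simp add: ennreal_mult ennreal_plus)
  finally show ?thesis
    using Y assms by (subst (asm) ennreal_le_iff) auto
qed

text \<open>Comparing on [w, b] costs \<epsilon> (b - w), and \<alpha> w + \<epsilon> (b - w) =
  \<epsilon> b + (\<alpha> - \<epsilon>) w. This produces both the constant term and the new level
  \<alpha> - \<epsilon>.\<close>

lemma mult_CVaR_upper:
  assumes M: "prob_space M" and N: "prob_space N" and X: "integrable M X" and Y: "integrable N Y"
    and cdf: "\<And>z. cdf (distr N borel Y) z - cdf (distr M borel X) z \<le> \<epsilon>"
    and \<epsilon>: "0 \<le> \<epsilon>" "\<epsilon> < \<alpha>" "\<alpha> \<le> 1"
    and b: "AE \<omega> in M. X \<omega> \<le> b" "AE \<omega> in N. Y \<omega> \<le> b"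
  shows "\<alpha> * CVaR M \<alpha> X \<le> \<epsilon> * b + (\<alpha> - \<epsilon>) * CVaR N (\<alpha> - \<epsilon>) Y"
proof -
  interpret M: prob_space M by fact
  interpret N: prob_space N by fact
  have low: "\<alpha> * CVaR M \<alpha> X \<le> \<epsilon> * b + ((\<alpha> - \<epsilon>) * w + expected_excess N Y w)" if "w \<le> b" for w
  proof -
    have "expected_excess M X w \<le> expected_excess N Y w + \<epsilon> * (b - w)"
      using expected_excess_compare[OF M N X Y cdf \<epsilon>(1) that]
      by (simp add: M.expected_excess_eq_0[OF b(1)] N.expected_excess_eq_0[OF b(2)])
    moreover have "\<alpha> * CVaR M \<alpha> X \<le> \<alpha> * w + expected_excess M X w"
      using X \<epsilon> by (intro M.mult_CVaR_le) auto
    ultimately show ?thesis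
      by (simp add: algebra_simps)
  qed
  have "\<alpha> * CVaR M \<alpha> X - \<epsilon> * b \<le> (\<alpha> - \<epsilon>) * w + expected_excess N Y w" for w
  proof (cases "w \<le> b")
    case True
    then show ?thesis using low[of w] by simp
  next
    case False
    \<comment> \<open>Beyond b the objective of Y is at least its value at b, where the excess
      vanishes, so the bound at b suffices.\<close>
    then have "(\<alpha> - \<epsilon>) * b \<le> (\<alpha> - \<epsilon>) * w"
      using \<epsilon> by (intro mult_left_mono) auto
    then show ?thesis
      using low[of b] N.expected_excess_nonneg[of Y w] N.expected_excess_eq_0[OF b(2)] by linarith
  qed
  then have "\<alpha> * CVaR M \<alpha> X - \<epsilon> * b \<le> (\<alpha> - \<epsilon>) * CVaR N (\<alpha> - \<epsilon>) Y"
    using Y \<epsilon> by (intro N.mult_CVaR_ge) auto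
  then show ?thesis by simp
qed

lemma (in prob_space) CVaR_le_bound:
  assumes "integrable M X" "0 < \<alpha>" "\<alpha> \<le> 1" "AE \<omega> in M. X \<omega> \<le> b"
  shows "CVaR M \<alpha> X \<le> b"
  using CVaR_le[OF assms(1-3), of b] expected_excess_eq_0[OF assms(4)] by simp

section \<open>The lower bounds\<close>

lemma excess_sum_ge:
  assumes M: "prob_space M" and N: "prob_space N" and X: "integrable M X" and Y: "integrable N Y"
    and cdf: "\<And>z. cdf (distr M borel X) z - cdf (distr N borel Y) z \<le> \<epsilon>"
    and \<alpha>: "0 \<le> \<alpha>" and \<epsilon>: "0 \<le> \<epsilon>"
  shows "(\<alpha> + \<epsilon>) * min w v + expected_excess N Y (min w v)
    \<le> (\<alpha> * w + expected_excess M X w) + (\<epsilon> * v + expected_excess N Y v)"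
proof (cases "w \<le> v")
  case True
  \<comment> \<open>The comparison is applied with X and Y exchanged, and the nonnegative excess of
    X at v is dropped.\<close>
  then show ?thesis
    using expected_excess_compare[OF N M Y X cdf \<epsilon> True] prob_space.expected_excess_nonneg[OF M, of X v]
    by (simp add: algebra_simps)
next
  case False
  then have "\<alpha> * v \<le> \<alpha> * w"
    using \<alpha> by (intro mult_left_mono) auto
  then show ?thesis
    using False prob_space.expected_excess_nonneg[OF M, of X w] by (simp add: algebra_simps)
qed

text \<open>The two infima are taken one after the other: over v with w fixed, then over w.\<close>

lemma sum_mult_CVaR_ge:
  assumes "prob_space M" "prob_space N" "integrable M X" "integrable N Y" "0 \<le> \<alpha>" "0 \<le> \<epsilon>"
    and c: "\<And>w v. c \<le> (\<alpha> * w + expected_excess M X w) + (\<epsilon> * v + expected_excess N Y v)"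
  shows "c \<le> \<alpha> * CVaR M \<alpha> X + \<epsilon> * CVaR N \<epsilon> Y"
proof -
  have "c - (\<alpha> * w + expected_excess M X w) \<le> \<epsilon> * CVaR N \<epsilon> Y" for w
    using c[of w] assms by (intro prob_space.mult_CVaR_ge) (auto simp: algebra_simps)
  then have "c - \<epsilon> * CVaR N \<epsilon> Y \<le> \<alpha> * CVaR M \<alpha> X"
    using assms by (intro prob_space.mult_CVaR_ge) (auto simp: algebra_simps)
  then show ?thesis by simp
qed

lemma mult_CVaR_lower:
  assumes M: "prob_space M" and N: "prob_space N" and X: "integrable M X" and Y: "integrable N Y"
    and cdf: "\<And>z. cdf (distr M borel X) z - cdf (distr N borel Y) z \<le> \<epsilon>"
    and "0 < \<alpha>" "0 \<le> \<epsilon>" "\<alpha> + \<epsilon> \<le> 1"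
  shows "(\<alpha> + \<epsilon>) * CVaR N (\<alpha> + \<epsilon>) Y \<le> \<alpha> * CVaR M \<alpha> X + \<epsilon> * CVaR N \<epsilon> Y"
proof (rule sum_mult_CVaR_ge[OF M N X Y])
  show "(\<alpha> + \<epsilon>) * CVaR N (\<alpha> + \<epsilon>) Y
    \<le> (\<alpha> * w + expected_excess M X w) + (\<epsilon> * v + expected_excess N Y v)" for w v
  proof (rule order_trans)
    show "(\<alpha> + \<epsilon>) * CVaR N (\<alpha> + \<epsilon>) Y \<le> (\<alpha> + \<epsilon>) * min w v + expected_excess N Y (min w v)"
      using assms by (intro prob_space.mult_CVaR_le) auto
    show "\<dots> \<le> (\<alpha> * w + expected_excess M X w) + (\<epsilon> * v + expected_excess N Y v)"
      using assms by (intro excess_sum_ge) auto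
  qed
qed (use assms in auto)

text \<open>For \<alpha> + \<epsilon> > 1 the objective of Y at level \<alpha> + \<epsilon> tends to
  minus infinity as u does, so no CVaR at that level can serve as the bound. Restricted to u >= a,
  it is at least E[Y] + (\<alpha> + \<epsilon> - 1) u, hence at least the value at u = a of this
  line.\<close>

lemma mult_CVaR_lower_mean:
  assumes M: "prob_space M" and N: "prob_space N" and X: "integrable M X" and Y: "integrable N Y"
    and cdf: "\<And>z. cdf (distr M borel X) z - cdf (distr N borel Y) z \<le> \<epsilon>"
    and \<alpha>: "0 \<le> \<alpha>" "\<alpha> \<le> 1" and \<epsilon>: "0 \<le> \<epsilon>" "\<epsilon> \<le> 1" "1 \<le> \<alpha> + \<epsilon>"
    and a: "AE \<omega> in M. a \<le> X \<omega>" "AE \<omega> in N. a \<le> Y \<omega>"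
  shows "(\<integral>\<omega>. Y \<omega> \<partial>N) + (\<alpha> + \<epsilon> - 1) * a \<le> \<alpha> * CVaR M \<alpha> X + \<epsilon> * CVaR N \<epsilon> Y"
proof (rule sum_mult_CVaR_ge[OF M N X Y])
  interpret M: prob_space M by fact
  interpret N: prob_space N by fact
  fix w v
  \<comment> \<open>Both objectives are nonincreasing on \<open>(-\<infinity>, a]\<close>, so \<open>w\<close> and \<open>v\<close> may be moved up to \<open>a\<close>.\<close>
  have w: "\<alpha> * max w a + expected_excess M X (max w a) \<le> \<alpha> * w + expected_excess M X w"
  proof (cases "w \<le> a")
    case True
    then have "(1 - \<alpha>) * w \<le> (1 - \<alpha>) * a"
      using \<alpha> by (intro mult_left_mono) auto
    then show ?thesis
      using True M.expected_excess_eq_mean[OF X a(1), of w] M.expected_excess_eq_mean[OF X a(1), of a]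
      by (simp add: max_absorb2 left_diff_distrib)
  qed simp
  have v: "\<epsilon> * max v a + expected_excess N Y (max v a) \<le> \<epsilon> * v + expected_excess N Y v"
  proof (cases "v \<le> a")
    case True
    then have "(1 - \<epsilon>) * v \<le> (1 - \<epsilon>) * a"
      using \<epsilon> by (intro mult_left_mono) auto
    then show ?thesis
      using True N.expected_excess_eq_mean[OF Y a(2), of v] N.expected_excess_eq_mean[OF Y a(2), of a]
      by (simp add: max_absorb2 left_diff_distrib)
  qed simp
  define u where "u = min (max w a) (max v a)"
  have "(\<alpha> + \<epsilon> - 1) * a \<le> (\<alpha> + \<epsilon> - 1) * u"
    using \<epsilon> unfolding u_def by (intro mult_left_mono) auto
  then have "N.expectation Y + (\<alpha> + \<epsilon> - 1) * a \<le> (\<alpha> + \<epsilon>) * u + expected_excess N Y u"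
    using N.expected_excess_ge_mean[OF Y, of u] by (simp add: algebra_simps)
  also have "\<dots> \<le> (\<alpha> * max w a + expected_excess M X (max w a)) + (\<epsilon> * max v a + expected_excess N Y (max v a))"
    unfolding u_def by (rule excess_sum_ge[OF M N X Y cdf \<alpha>(1) \<epsilon>(1)])
  finally show "N.expectation Y + (\<alpha> + \<epsilon> - 1) * a
    \<le> (\<alpha> * w + expected_excess M X w) + (\<epsilon> * v + expected_excess N Y v)"
    using w v by linarith
qed (use assms in auto)

section \<open>The four bounds, after division by \<alpha>\<close>

theorem theorem5p1:
  fixes M :: "'a measure" and N :: "'b measure"
    and X :: "'a \<Rightarrow> real" and Y :: "'b \<Rightarrow> real"
    and \<alpha> \<epsilon> a\<^sub>X a\<^sub>Y b\<^sub>X b\<^sub>Y :: real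
  assumes "prob_space M" and "prob_space N"
    and "integrable M X" and "integrable N Y"
    and "0 < \<alpha>" and "\<alpha> < 1"
    and "0 \<le> \<epsilon>" and "\<epsilon> \<le> 1"
  shows
    "(\<P>(\<omega> in M. X \<omega> \<le> b\<^sub>X) = 1 \<and> \<P>(\<omega> in N. Y \<omega> \<le> b\<^sub>Y) = 1
        \<and> (\<forall>z::real. cdf (distr N borel Y) z - cdf (distr M borel X) z \<le> \<epsilon>)
      \<longrightarrow> (\<alpha> > \<epsilon> \<longrightarrow>
             CVaR M \<alpha> X \<le> \<epsilon> / \<alpha> * max b\<^sub>X b\<^sub>Y + (1 - \<epsilon> / \<alpha>) * CVaR N (\<alpha> - \<epsilon>) Y)
        \<and> (\<alpha> \<le> \<epsilon> \<longrightarrow> CVaR M \<alpha> X \<le> max b\<^sub>X b\<^sub>Y))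
     \<and>
     (\<P>(\<omega> in M. X \<omega> \<ge> a\<^sub>X) = 1 \<and> \<P>(\<omega> in N. Y \<omega> \<ge> a\<^sub>Y) = 1
        \<and> (\<forall>z::real. cdf (distr M borel X) z - cdf (distr N borel Y) z \<le> \<epsilon>)
      \<longrightarrow> (\<alpha> + \<epsilon> \<le> 1 \<longrightarrow>
             CVaR M \<alpha> X \<ge> (1 + \<epsilon> / \<alpha>) * CVaR N (\<alpha> + \<epsilon>) Y - \<epsilon> / \<alpha> * CVaR N \<epsilon> Y)
        \<and> (\<alpha> + \<epsilon> > 1 \<longrightarrow>
             CVaR M \<alpha> X \<ge> 1 / \<alpha> *
               ((\<integral>\<omega>. Y \<omega> \<partial>N) - \<epsilon> * CVaR N \<epsilon> Y + (\<alpha> + \<epsilon> - 1) * min a\<^sub>X a\<^sub>Y)))"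
proof (intro conjI impI; elim conjE)
  interpret M: prob_space M by fact
  interpret N: prob_space N by fact
  have [measurable]: "X \<in> borel_measurable M" "Y \<in> borel_measurable N"
    using assms by auto
  have AE_M: "AE \<omega> in M. P (X \<omega>)" if "\<P>(\<omega> in M. P (X \<omega>)) = 1" "Measurable.pred borel P" for P
    using that M.prob_Collect_eq_1[of "\<lambda>\<omega>. P (X \<omega>)"] by simp
  have AE_N: "AE \<omega> in N. P (Y \<omega>)" if "\<P>(\<omega> in N. P (Y \<omega>)) = 1" "Measurable.pred borel P" for P
    using that N.prob_Collect_eq_1[of "\<lambda>\<omega>. P (Y \<omega>)"] by simp
  {
    assume b: "\<P>(\<omega> in M. X \<omega> \<le> b\<^sub>X) = 1" "\<P>(\<omega> in N. Y \<omega> \<le> b\<^sub>Y) = 1"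
      and cdf: "\<forall>z. cdf (distr N borel Y) z - cdf (distr M borel X) z \<le> \<epsilon>"
    \<comment> \<open>One common bound for both variables makes both excesses vanish at the same
      threshold.\<close>
    have bX: "AE \<omega> in M. X \<omega> \<le> max b\<^sub>X b\<^sub>Y"
      using AE_M[OF b(1)] by (auto simp: le_max_iff_disj)
    have bY: "AE \<omega> in N. Y \<omega> \<le> max b\<^sub>X b\<^sub>Y"
      using AE_N[OF b(2)] by (auto simp: le_max_iff_disj)
    show "CVaR M \<alpha> X \<le> max b\<^sub>X b\<^sub>Y"
      using assms bX by (intro M.CVaR_le_bound) auto
    assume "\<epsilon> < \<alpha>"
    then have "\<alpha> * CVaR M \<alpha> X \<le> \<epsilon> * max b\<^sub>X b\<^sub>Y + (\<alpha> - \<epsilon>) * CVaR N (\<alpha> - \<epsilon>) Y"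
      using assms cdf bX bY by (intro mult_CVaR_upper) auto
    then show "CVaR M \<alpha> X \<le> \<epsilon> / \<alpha> * max b\<^sub>X b\<^sub>Y + (1 - \<epsilon> / \<alpha>) * CVaR N (\<alpha> - \<epsilon>) Y"
      using \<open>0 < \<alpha>\<close> by (simp add: field_simps)
  }
  {
    assume a: "\<P>(\<omega> in M. a\<^sub>X \<le> X \<omega>) = 1" "\<P>(\<omega> in N. a\<^sub>Y \<le> Y \<omega>) = 1"
      and cdf: "\<forall>z. cdf (distr M borel X) z - cdf (distr N borel Y) z \<le> \<epsilon>"
    {
      assume "\<alpha> + \<epsilon> \<le> 1"
      then have "(\<alpha> + \<epsilon>) * CVaR N (\<alpha> + \<epsilon>) Y \<le> \<alpha> * CVaR M \<alpha> X + \<epsilon> * CVaR N \<epsilon> Y"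
        using assms cdf by (intro mult_CVaR_lower) auto
      then have "((\<alpha> + \<epsilon>) * CVaR N (\<alpha> + \<epsilon>) Y - \<epsilon> * CVaR N \<epsilon> Y) / \<alpha> \<le> CVaR M \<alpha> X"
        using \<open>0 < \<alpha>\<close> by (simp add: pos_divide_le_eq mult.commute)
      moreover have "((\<alpha> + \<epsilon>) * A - \<epsilon> * B) / \<alpha> = (1 + \<epsilon> / \<alpha>) * A - \<epsilon> / \<alpha> * B" for A B
        using \<open>0 < \<alpha>\<close> by (simp add: field_simps)
      ultimately show "(1 + \<epsilon> / \<alpha>) * CVaR N (\<alpha> + \<epsilon>) Y - \<epsilon> / \<alpha> * CVaR N \<epsilon> Y \<le> CVaR M \<alpha> X"
        by simp
    next
      assume "1 < \<alpha> + \<epsilon>"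
      \<comment> \<open>One common lower bound lets both thresholds be moved up to the same
        point.\<close>
      have aX: "AE \<omega> in M. min a\<^sub>X a\<^sub>Y \<le> X \<omega>"
        using AE_M[OF a(1)] by (auto simp: min_le_iff_disj)
      have aY: "AE \<omega> in N. min a\<^sub>X a\<^sub>Y \<le> Y \<omega>"
        using AE_N[OF a(2)] by (auto simp: min_le_iff_disj)
      have "(\<integral>\<omega>. Y \<omega> \<partial>N) + (\<alpha> + \<epsilon> - 1) * min a\<^sub>X a\<^sub>Y \<le> \<alpha> * CVaR M \<alpha> X + \<epsilon> * CVaR N \<epsilon> Y"
        using assms cdf aX aY \<open>1 < \<alpha> + \<epsilon>\<close> by (intro mult_CVaR_lower_mean) auto
      then show "1 / \<alpha> * ((\<integral>\<omega>. Y \<omega> \<partial>N) - \<epsilon> * CVaR N \<epsilon> Y + (\<alpha> + \<epsilon> - 1) * min a\<^sub>X a\<^sub>Y) \<le> CVaR M \<alpha> X"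
        using \<open>0 < \<alpha>\<close> by (simp add: field_simps)
    }
  }
qed

end
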